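(* For integers $n \ge 2$ define $\mathrm{ndg}_{\min}(n) = \min\{\Gamma_d(G) + \Gamma_d(\overline{G})\}$ and $\mathrm{ndg}_{\max}(n) = \max\{\Gamma_d(G) + \Gamma_d(\overline{G})\}$, where the minimum and maximum are over all graphs $G$ of order $n$. Then: (a) there are constants $c_1, c_2 > 0$ such that $c_1 \log n \le \mathrm{ndg}_{\min}(n) \le c_2 (\log n)^2$ for all $n \ge 2$; (b) $n + \log n - 2\log(\log n) \le \mathrm{ndg}_{\max}(n) \le n + \lceil n/2 \rceil$ for all $n \ge 2$.
   Context: $\log$ denotes the logarithm to base $2$; $\overline{G}$ is the complement of $G$. For a digraph $D$, a directed dominating set is a set $S \subseteq V(D)$ such that every vertex $u \notin S$ has a vertex $v \in S$ with arc $(v,u)$; $\gamma(D)$ is the minimum size of such a set. For a graph $G$, $\Gamma_d(G) = \max\{\gamma(D) : D \text{ an orientation of } G\}$. *)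

theory Defs
  imports Complex_Main "Graph_Theory.Pair_Digraph"
begin

text \<open>
  Finite simple graphs are the loop-free symmetric finite digraphs \<^const>\<open>pair_graph\<close>:
  an undirected edge \<open>uv\<close> is the pair of arcs \<open>(u, v)\<close>, \<open>(v, u)\<close>.
\<close>

definition graph_complement :: "'a pair_pre_digraph \<Rightarrow> 'a pair_pre_digraph" where
  "graph_complement G =
     \<lparr> pverts = pverts G,
       parcs = {(u, v). u \<in> pverts G \<and> v \<in> pverts G \<and> u \<noteq> v \<and> (u, v) \<notin> parcs G} \<rparr>"

definition orientation :: "'a pair_pre_digraph \<Rightarrow> 'a pair_pre_digraph \<Rightarrow> bool" where
  "orientation G D \<longleftrightarrow>
     pverts D = pverts G \<and> parcs D \<subseteq> parcs G \<and>
     (\<forall>(u, v) \<in> parcs G. ((u, v) \<in> parcs D) \<noteq> ((v, u) \<in> parcs D))"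

definition directed_dominating_set :: "'a pair_pre_digraph \<Rightarrow> 'a set \<Rightarrow> bool" where
  "directed_dominating_set D S \<longleftrightarrow>
     S \<subseteq> pverts D \<and> (\<forall>u \<in> pverts D - S. \<exists>v \<in> S. (v, u) \<in> parcs D)"

definition directed_domination_number :: "'a pair_pre_digraph \<Rightarrow> nat" where
  "directed_domination_number D = Min (card ` {S. directed_dominating_set D S})"

definition upper_directed_domination_number :: "'a pair_pre_digraph \<Rightarrow> nat" where
  "upper_directed_domination_number G =
     Max (directed_domination_number ` {D. orientation G D})"

text \<open>
  Every finite graph is isomorphic to one whose vertices are natural numbers, so the extrema
  are taken over graphs with vertex type \<^typ>\<open>nat\<close>.
\<close>

definition ndg_values :: "nat \<Rightarrow> nat set" where
  "ndg_values n =
     {upper_directed_domination_number G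
        + upper_directed_domination_number (graph_complement G) | G :: nat pair_pre_digraph.
      pair_graph G \<and> card (pverts G) = n}"

definition ndg_min :: "nat \<Rightarrow> nat" where
  "ndg_min n = Min (ndg_values n)"

definition ndg_max :: "nat \<Rightarrow> nat" where
  "ndg_max n = Max (ndg_values n)"

text \<open>
  The sets whose \<^const>\<open>Min\<close> and \<^const>\<open>Max\<close> are taken above are finite and nonempty.
\<close>

lemma dominating_cards_finite:
  assumes "finite (pverts D)"
  shows "finite (card ` {S. directed_dominating_set D S})"
  using assms finite_subset[of "{S. directed_dominating_set D S}" "Pow (pverts D)"]
  by (auto simp: directed_dominating_set_def)

lemma dominating_cards_nonempty: "card ` {S. directed_dominating_set D S} \<noteq> {}"
proof -
  have "directed_dominating_set D (pverts D)"
    by (simp add: directed_dominating_set_def)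
  then show ?thesis by blast
qed

lemma directed_domination_number_le:
  assumes "finite (pverts D)"
  shows "directed_domination_number D \<le> card (pverts D)"
proof -
  have "directed_dominating_set D (pverts D)"
    by (simp add: directed_dominating_set_def)
  then show ?thesis
    unfolding directed_domination_number_def
    by (intro Min_le dominating_cards_finite assms) blast
qed

lemma orientation_domination_number_le:
  assumes "pair_graph G" and "orientation G D"
  shows "directed_domination_number D \<le> card (pverts G)"
proof -
  interpret pair_graph G by fact
  have "pverts D = pverts G"
    using assms(2) by (simp add: orientation_def)
  then show ?thesis
    using directed_domination_number_le[of D] pair_finite_verts by simp
qed

lemma orientation_values_finite:
  assumes "pair_graph G"
  shows "finite (directed_domination_number ` {D. orientation G D})"
proof -
  have "directed_domination_number ` {D. orientation G D} \<subseteq> {..card (pverts G)}"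
    using orientation_domination_number_le[OF assms] by blast
  then show ?thesis by (rule finite_subset) simp
qed

lemma orientation_values_nonempty:
  assumes "pair_graph (G :: 'a pair_pre_digraph)"
  shows "directed_domination_number ` {D. orientation G D} \<noteq> {}"
proof -
  interpret pair_graph G by fact
  obtain f :: "'a \<Rightarrow> nat" where f: "inj_on f (pverts G)"
    using finite_imp_inj_to_nat_seg pair_finite_verts by meson
  let ?D = "\<lparr> pverts = pverts G, parcs = {(u, v) \<in> parcs G. f u < f v} \<rparr>"
  have "(f u < f v) \<noteq> (f v < f u)" if "(u, v) \<in> parcs G" for u v
    using that f in_arcsD1 in_arcsD2 no_loops' by (metis inj_onD linorder_neqE_nat not_less_iff_gr_or_eq)
  then have "orientation G ?D"
    by (auto simp: orientation_def dest: arcs_symmetric)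
  then show ?thesis by blast
qed

lemma pair_graph_complement:
  assumes "pair_graph G"
  shows "pair_graph (graph_complement G)"
proof -
  interpret pair_graph G by fact
  have "finite (parcs (graph_complement G))"
    by (rule finite_subset[of _ "pverts G \<times> pverts G"])
      (auto simp: graph_complement_def pair_finite_verts)
  then show ?thesis
    using pair_finite_verts arcs_symmetric
    by unfold_locales (auto simp: graph_complement_def symmetric_def sym_def)
qed

lemma upper_directed_domination_number_le:
  assumes "pair_graph G"
  shows "upper_directed_domination_number G \<le> card (pverts G)"
proof -
  have "upper_directed_domination_number G \<in> directed_domination_number ` {D. orientation G D}"
    unfolding upper_directed_domination_number_def
    by (rule Max_in[OF orientation_values_finite[OF assms] orientation_values_nonempty[OF assms]])
  then show ?thesis
    using orientation_domination_number_le[OF assms] by force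
qed

lemma ndg_values_finite: "finite (ndg_values n)"
proof -
  have "ndg_values n \<subseteq> {..2 * n}"
  proof
    fix x assume "x \<in> ndg_values n"
    then obtain G :: "nat pair_pre_digraph" where G: "pair_graph G" "card (pverts G) = n"
      and x: "x = upper_directed_domination_number G
                    + upper_directed_domination_number (graph_complement G)"
      by (auto simp: ndg_values_def)
    from G show "x \<in> {..2 * n}"
      using upper_directed_domination_number_le[of G]
        upper_directed_domination_number_le[OF pair_graph_complement, of G] x
      by (simp add: graph_complement_def)
  qed
  then show ?thesis by (rule finite_subset) simp
qed

lemma ndg_values_nonempty: "ndg_values n \<noteq> {}"
proof -
  have "pair_graph \<lparr> pverts = {..<n}, parcs = {} \<rparr>"
    by unfold_locales (auto simp: symmetric_def sym_def)
  then show ?thesis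
    unfolding ndg_values_def by fastforce
qed

end

theory Submission
  imports Defs
begin

text \<open>
  Two estimates of \<open>\<Gamma>\<^sub>d(G)\<close> through the independence number \<open>\<alpha>(G)\<close> give part (a):
  \<open>\<alpha>(G) \<le> \<Gamma>\<^sub>d(G)\<close>, by orienting all edges away from an independent set, and
  \<open>\<Gamma>\<^sub>d(G) \<le> 2 \<alpha>(G) ln n + 1\<close>, since every set \<open>U\<close> of undominated vertices contains a vertex
  dominating at least \<open>|U| / (2 \<alpha>(G))\<close> of them. Ramsey's argument yields
  \<open>\<alpha>(G) + \<omega>(G) \<ge> log n\<close> for every graph, and counting yields a graph in which both are at most
  \<open>3 log n\<close>.

  In part (b), each pair of a maximum matching of the complete graph is an edge of \<open>G\<close> or of its
  complement and saves one vertex in the corresponding dominating set. For the lower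
  bound take \<open>G\<close> empty and orient its complement as a random tournament (Erdos).
\<close>

section \<open>Bounding \<open>\<Gamma>\<^sub>d\<close> from either side through dominating
  sets\<close>

text \<open>The entry point for upper bounds: fix an extremal orientation, and every dominating set
  exhibited in it bounds \<open>\<Gamma>\<^sub>d(G)\<close>.\<close>

lemma upper_directed_domination_number_attained:
  assumes G: "pair_graph G"
  obtains D where "orientation G D"
    and "\<And>S. directed_dominating_set D S \<Longrightarrow> upper_directed_domination_number G \<le> card S"
proof -
  interpret pair_graph G by fact
  have "upper_directed_domination_number G \<in> directed_domination_number ` {D. orientation G D}"
    unfolding upper_directed_domination_number_def
    by (rule Max_in[OF orientation_values_finite[OF G] orientation_values_nonempty[OF G]])
  then obtain D where D: "orientation G D"
      "upper_directed_domination_number G = directed_domination_number D" by auto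
  have "finite (pverts D)"
    using D pair_finite_verts by (simp add: orientation_def)
  then have "directed_domination_number D \<le> card S" if "directed_dominating_set D S" for S
    unfolding directed_domination_number_def
    using that by (intro Min_le dominating_cards_finite) auto
  with D show ?thesis using that by simp
qed

text \<open>The entry point for lower bounds: one orientation without small dominating sets
  suffices.\<close>

lemma upper_directed_domination_number_geI:
  assumes G: "pair_graph G" and D: "orientation G D"
    and S: "\<And>S. directed_dominating_set D S \<Longrightarrow> m \<le> card S"
  shows "m \<le> upper_directed_domination_number G"
proof -
  interpret pair_graph G by fact
  have "finite (pverts D)"
    using D pair_finite_verts by (simp add: orientation_def)
  then have "m \<le> directed_domination_number D"
    unfolding directed_domination_number_def
    using S dominating_cards_nonempty[of D]
    by (subst Min_ge_iff) (auto intro: dominating_cards_finite)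
  also have "\<dots> \<le> upper_directed_domination_number G"
    unfolding upper_directed_domination_number_def
    using D orientation_values_finite[OF G] by (intro Max_ge) auto
  finally show ?thesis .
qed

lemma pverts_graph_complement [simp]: "pverts (graph_complement G) = pverts G"
  by (simp add: graph_complement_def)

section \<open>Independent sets as a lower bound for \<open>\<Gamma>\<^sub>d\<close>\<close>

text \<open>Stated for an arbitrary relation, so that it serves for graphs, for orientations and,
  with \<open>- R\<close>, for cliques. In the last case \<open>u \<noteq> v\<close> matters, since
  \<open>- R\<close> contains the diagonal when \<open>R\<close> is loop-free.\<close>

definition independent_in :: "('a \<times> 'a) set \<Rightarrow> 'a set \<Rightarrow> bool" where
  "independent_in R I \<longleftrightarrow> (\<forall>u\<in>I. \<forall>v\<in>I. u \<noteq> v \<longrightarrow> (u, v) \<notin> R)"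

text \<open>Adjacency in \<open>G\<close> means an arc of \<open>D\<close> in one of the two
  directions, and independence quantifies over both ordered pairs. This carries a bound on
  independent sets from \<open>G\<close> over to its orientations.\<close>

lemma independent_in_orientation:
  assumes G: "pair_graph G" and "orientation G D"
  shows "independent_in (parcs D) I \<longleftrightarrow> independent_in (parcs G) I"
proof -
  interpret pair_graph G by fact
  have "(u, v) \<in> parcs G \<longleftrightarrow> (u, v) \<in> parcs D \<or> (v, u) \<in> parcs D" for u v
    using assms(2) arcs_symmetric unfolding orientation_def by auto
  then show ?thesis
    unfolding independent_in_def by metis
qed

text \<open>Orient every edge meeting \<open>I\<close> away from \<open>I\<close>: then the vertices of \<open>I\<close> have no
  in-neighbours, so \<open>I\<close> lies in every dominating set.\<close>

lemma independent_card_le_upper_directed_domination_number: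
  fixes G :: "'a pair_pre_digraph"
  assumes G: "pair_graph G" and I: "I \<subseteq> pverts G" "independent_in (parcs G) I"
  shows "card I \<le> upper_directed_domination_number G"
proof -
  interpret pair_graph G by fact
  obtain f :: "'a \<Rightarrow> nat" where f: "inj_on f (pverts G)"
    using finite_imp_inj_to_nat_seg pair_finite_verts by meson
  let ?D = "\<lparr> pverts = pverts G,
     parcs = {(u, v) \<in> parcs G. v \<notin> I \<and> (u \<in> I \<or> f u < f v)} \<rparr>"
  have *: "(f u < f v) \<noteq> (f v < f u)" if "(u, v) \<in> parcs G" for u v
    using that f in_arcsD1 in_arcsD2 no_loops'
    by (metis inj_onD linorder_neqE_nat not_less_iff_gr_or_eq)
  have **: "u \<notin> I \<or> v \<notin> I" if "(u, v) \<in> parcs G" for u v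
    using that I no_loops' unfolding independent_in_def by blast
  have "((u, v) \<in> parcs ?D) \<noteq> ((v, u) \<in> parcs ?D)" if "(u, v) \<in> parcs G" for u v
    using *[OF that] **[OF that] arcs_symmetric[OF that] that by auto
  then have "orientation G ?D"
    unfolding orientation_def by auto
  moreover have "card I \<le> card S" if S: "directed_dominating_set ?D S" for S
  proof (rule card_mono)
    show "finite S"
      using S pair_finite_verts by (auto simp: directed_dominating_set_def intro: finite_subset)
    show "I \<subseteq> S"
      using S I(1) by (auto simp: directed_dominating_set_def)
  qed
  ultimately show ?thesis
    by (rule upper_directed_domination_number_geI[OF G])
qed

section \<open>Ramsey's argument and the lower bound of part (a)\<close>

text \<open>A vertex \<open>v\<close> extends any clique among its neighbours and any independent
  set among its non-neighbours. Recursing into the larger of the two classes about halves the set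
  and gains one vertex.\<close>

lemma exists_large_clique_or_independent:
  assumes "finite V" "sym R"
  shows "\<exists>K I. K \<subseteq> V \<and> I \<subseteq> V \<and> independent_in (- R) K \<and> independent_in R I \<and>
           card V < 2 ^ (card K + card I)"
  using assms(1)
proof (induction V rule: finite_psubset_induct)
  case (psubset V)
  show ?case
  proof (cases "V = {}")
    case True
    then show ?thesis by (auto simp: independent_in_def)
  next
    case False
    then obtain v where v: "v \<in> V" by blast
    let ?A = "{u \<in> V - {v}. (v, u) \<in> R}" and ?B = "{u \<in> V - {v}. (v, u) \<notin> R}"
    have fin: "finite ?A" "finite ?B" using psubset.hyps by auto
    have "card V = Suc (card (V - {v}))"
      using v psubset.hyps by (metis card_Suc_Diff1)
    also have "card (V - {v}) = card (?A \<union> ?B)"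
      by (rule arg_cong[of _ _ card]) auto
    also have "\<dots> = card ?A + card ?B"
      using fin by (intro card_Un_disjoint) auto
    finally have cV: "card V = Suc (card ?A + card ?B)" .
    have "?A \<subset> V" "?B \<subset> V" using v by auto
    then obtain K I K' I' where A: "K \<subseteq> ?A" "I \<subseteq> ?A" "independent_in (- R) K"
        "independent_in R I" "card ?A < 2 ^ (card K + card I)"
      and B: "K' \<subseteq> ?B" "I' \<subseteq> ?B" "independent_in (- R) K'"
        "independent_in R I'" "card ?B < 2 ^ (card K' + card I')"
      using psubset.IH[of ?A] psubset.IH[of ?B] by blast
    show ?thesis
    proof (cases "card ?B \<le> card ?A")
      case True
      have "independent_in (- R) (insert v K)"
        using A(1,3) \<open>sym R\<close> unfolding independent_in_def sym_def by blast
      moreover have "card (insert v K) = Suc (card K)"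
        using A(1) fin by (subst card_insert_disjoint) (auto intro: finite_subset)
      \<comment> \<open>With \<open>m = card K + card I\<close>, the strict bound
        \<open>card ?A + 1 \<le> 2 ^ m\<close> absorbs the vertex \<open>v\<close>:
        \<open>card V \<le> 2 * card ?A + 1 < 2 ^ (m + 1)\<close>.\<close>
      then have "card V < 2 ^ (card (insert v K) + card I)"
        using cV True A(5) by simp
      ultimately show ?thesis
        using A v by (intro exI[of _ "insert v K"] exI[of _ I]) auto
    next
      case False
      have "independent_in R (insert v I')"
        using B(2,4) \<open>sym R\<close> unfolding independent_in_def sym_def by blast
      moreover have "card (insert v I') = Suc (card I')"
        using B(2) fin by (subst card_insert_disjoint) (auto intro: finite_subset)
      then have "card V < 2 ^ (card K' + card (insert v I'))"
        using cV False B(5) by simp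
      ultimately show ?thesis
        using B v by (intro exI[of _ K'] exI[of _ "insert v I'"]) auto
    qed
  qed
qed

text \<open>A clique of \<open>G\<close> is independent in the complement, so the Ramsey clique and
  independent set bound one summand each.\<close>

lemma log_card_le_sum_upper_directed_domination_numbers:
  assumes G: "pair_graph G" and "pverts G \<noteq> {}"
  shows "log 2 (card (pverts G)) \<le>
    upper_directed_domination_number G + upper_directed_domination_number (graph_complement G)"
proof -
  interpret pair_graph G by fact
  have "sym (parcs G)" using arcs_symmetric by (auto simp: sym_def)
  from exists_large_clique_or_independent[OF pair_finite_verts this]
  obtain K I where KI: "K \<subseteq> pverts G" "I \<subseteq> pverts G" "independent_in (- parcs G) K"
      "independent_in (parcs G) I" "card (pverts G) < 2 ^ (card K + card I)"
    by metis
  have "independent_in (parcs (graph_complement G)) K"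
    using KI(3) by (auto simp: independent_in_def graph_complement_def)
  then have "card K \<le> upper_directed_domination_number (graph_complement G)"
    using KI(1) pair_graph_complement[OF G]
    by (intro independent_card_le_upper_directed_domination_number) auto
  moreover have "card I \<le> upper_directed_domination_number G"
    using KI G by (intro independent_card_le_upper_directed_domination_number)
  moreover have "card (pverts G) > 0"
    using assms(2) pair_finite_verts by (simp add: card_gt_0_iff)
  then have "log 2 (card (pverts G)) \<le> card K + card I"
    using KI(5) by (intro log2_of_power_le) auto
  ultimately show ?thesis by simp
qed

section \<open>Greedy domination when independent sets are small\<close>

text \<open>If all out-degrees are at most \<open>d\<close> then, by double counting, so is some in-degree;
  repeatedly choosing such a vertex and discarding its at most \<open>2 * d\<close> neighbours yields a
  large independent set.\<close>

lemma exists_independent_of_outdegree_le: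
  assumes "finite V" "\<And>v. v \<in> V \<Longrightarrow> card {u \<in> V. (v, u) \<in> R} \<le> d"
  shows "\<exists>I. I \<subseteq> V \<and> independent_in R I \<and> card V \<le> card I * (2 * d + 1)"
  using assms
proof (induction V rule: finite_psubset_induct)
  case (psubset V)
  show ?case
  proof (cases "V = {}")
    case True
    then show ?thesis by (auto simp: independent_in_def)
  next
    case False
    note fin = psubset.hyps(1)
    have "\<exists>v\<in>V. card {u \<in> V. (u, v) \<in> R} \<le> d"
    proof (rule ccontr)
      assume "\<not> ?thesis"
      then have "(\<Sum>v\<in>V. d) < (\<Sum>v\<in>V. card {u \<in> V. (u, v) \<in> R})"
        using fin False by (intro sum_strict_mono) auto
      also have "\<dots> = (\<Sum>v\<in>V. card {u \<in> V. (v, u) \<in> R})"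
        using fin sum.swap[of "\<lambda>u v. if (u, v) \<in> R then 1 else 0 :: nat" V V]
        by (simp only: card_eq_sum sum.inter_filter)
      also have "\<dots> \<le> (\<Sum>v\<in>V. d)"
        using psubset.prems by (rule sum_mono)
      finally show False by simp
    qed
    then obtain v where v: "v \<in> V" "card {u \<in> V. (u, v) \<in> R} \<le> d" by blast
    define W where "W = insert v ({u \<in> V. (u, v) \<in> R} \<union> {u \<in> V. (v, u) \<in> R})"
    have "W \<subseteq> V" using v by (auto simp: W_def)
    have "card W \<le> Suc (card ({u \<in> V. (u, v) \<in> R} \<union> {u \<in> V. (v, u) \<in> R}))"
      unfolding W_def using fin by (simp add: card_insert_if)
    also have "\<dots> \<le> Suc (card {u \<in> V. (u, v) \<in> R} + card {u \<in> V. (v, u) \<in> R})"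
      using card_Un_le by simp
    finally have cW: "card W \<le> 2 * d + 1"
      using v psubset.prems[of v] by simp
    have "V - W \<subset> V" using v by (auto simp: W_def)
    moreover have "card {u \<in> V - W. (w, u) \<in> R} \<le> d" if "w \<in> V - W" for w
    proof -
      have "card {u \<in> V - W. (w, u) \<in> R} \<le> card {u \<in> V. (w, u) \<in> R}"
        using fin by (intro card_mono) auto
      then show ?thesis using psubset.prems[of w] that by simp
    qed
    ultimately obtain I where I: "I \<subseteq> V - W" "independent_in R I"
        "card (V - W) \<le> card I * (2 * d + 1)"
      using psubset.IH[of "V - W"] by blast
    have "independent_in R (insert v I)"
      using I(1,2) unfolding independent_in_def W_def by blast
    moreover have "card (insert v I) = Suc (card I)"
      using I(1) fin by (subst card_insert_disjoint) (auto intro: finite_subset simp: W_def)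
    moreover have "card V = card (V - W) + card W"
      using \<open>W \<subseteq> V\<close> fin by (metis card_Diff_subset card_mono finite_subset le_add_diff_inverse2)
    ultimately show ?thesis
      using I v cW by (intro exI[of _ "insert v I"]) auto
  qed
qed

text \<open>For the maximum out-degree \<open>d\<close> inside \<open>U\<close>, the previous lemma
  gives \<open>card U \<le> a * (2 * d + 1) \<le> 2 * a * (d + 1)\<close>, and \<open>d + 1\<close>
  counts a vertex of maximum out-degree together with its out-neighbours.\<close>

lemma exists_vertex_large_outdegree:
  assumes "finite U" "U \<noteq> {}" "\<And>v. (v, v) \<notin> R"
    and a: "\<And>I. I \<subseteq> U \<Longrightarrow> independent_in R I \<Longrightarrow> card I \<le> a"
  shows "\<exists>v\<in>U. card U \<le> 2 * a * card (insert v {u \<in> U. (v, u) \<in> R})"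
proof -
  let ?d = "Max ((\<lambda>v. card {u \<in> U. (v, u) \<in> R}) ` U)"
  have "?d \<in> (\<lambda>v. card {u \<in> U. (v, u) \<in> R}) ` U"
    using assms by (intro Max_in) auto
  then obtain v where v: "v \<in> U" "card {u \<in> U. (v, u) \<in> R} = ?d" by force
  have "card {u \<in> U. (w, u) \<in> R} \<le> ?d" if "w \<in> U" for w
    using assms that by (intro Max_ge) auto
  then obtain I where I: "I \<subseteq> U" "independent_in R I" "card U \<le> card I * (2 * ?d + 1)"
    using exists_independent_of_outdegree_le[OF assms(1), of R ?d] by blast
  have "card U \<le> a * (2 * ?d + 1)"
    using I a[of I] by (meson le_trans mult_le_mono1)
  also have "\<dots> \<le> 2 * a * Suc ?d" by simp
  also have "Suc ?d = card (insert v {u \<in> U. (v, u) \<in> R})"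
    using v assms by (subst card_insert_disjoint) auto
  finally show ?thesis using v by blast
qed

text \<open>Each greedy step adds an undominated vertex that takes care of at least a fraction
  \<open>1 / (2 * a)\<close> of the undominated vertices, itself included.\<close>

lemma greedy_domination:
  fixes D :: "'a pair_pre_digraph"
  assumes fin: "finite (pverts D)" and loopless: "\<And>v. (v, v) \<notin> parcs D" and "a \<ge> 1"
    and a: "\<And>I. I \<subseteq> pverts D \<Longrightarrow> independent_in (parcs D) I \<Longrightarrow> card I \<le> a"
  shows "\<exists>S\<subseteq>pverts D. card S \<le> t \<and>
    real (card {u \<in> pverts D - S. \<forall>v\<in>S. (v, u) \<notin> parcs D})
      \<le> card (pverts D) * (1 - 1 / (2 * real a)) ^ t"
proof (induction t)
  case 0
  show ?case by (intro exI[of _ "{}"]) simp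
next
  case (Suc t)
  let ?U = "\<lambda>S. {u \<in> pverts D - S. \<forall>v\<in>S. (v, u) \<notin> parcs D}"
  let ?q = "1 - 1 / (2 * real a)"
  from Suc obtain S where S: "S \<subseteq> pverts D" "card S \<le> t"
    "real (card (?U S)) \<le> card (pverts D) * ?q ^ t" by blast
  have q: "0 \<le> ?q" using \<open>a \<ge> 1\<close> by (simp add: field_simps)
  show ?case
  \<comment> \<open>Once everything is dominated \<open>S\<close> is kept, which is why its size is
    only bounded by \<open>t\<close>.\<close>
  proof (cases "?U S = {}")
    case True
    then show ?thesis
      using S q by (intro exI[of _ S]) (auto simp del: Collect_empty_eq intro!: mult_nonneg_nonneg)
  next
    case False
    have finU: "finite (?U S)" using fin by simp
    obtain v where v: "v \<in> ?U S"
      "card (?U S) \<le> 2 * a * card (insert v {u \<in> ?U S. (v, u) \<in> parcs D})"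
      using exists_vertex_large_outdegree[OF finU False loopless, of a] a by blast
    let ?W = "insert v {u \<in> ?U S. (v, u) \<in> parcs D}"
    have W: "?W \<subseteq> ?U S" using v(1) by blast
    \<comment> \<open>\<open>v\<close> leaves the undominated set by joining \<open>S\<close>, the
      rest of \<open>?W\<close> by being dominated by \<open>v\<close>.\<close>
    have "?U (insert v S) = ?U S - ?W" by blast
    then have "card (?U (insert v S)) + card ?W = card (?U S)"
      using W finU by (metis (no_types, lifting) card_Diff_subset card_mono finite_subset le_add_diff_inverse2)
    then have "real (card (?U (insert v S))) = card (?U S) - real (card ?W)"
      by linarith
    also have "\<dots> \<le> card (?U S) * ?q"
    proof -
      have "real (card (?U S)) \<le> real (2 * a * card ?W)"
        using v(2) of_nat_le_iff by blast
      then show ?thesis using \<open>a \<ge> 1\<close> by (simp add: field_simps)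
    qed
    also have "\<dots> \<le> (card (pverts D) * ?q ^ t) * ?q"
      using S(3) q by (rule mult_right_mono)
    finally have "real (card (?U (insert v S))) \<le> card (pverts D) * ?q ^ Suc t"
      by (simp add: mult_ac)
    moreover have "card (insert v S) \<le> Suc t"
      using S(2) finite_subset[OF S(1) fin] by (simp add: card_insert_if)
    ultimately show ?thesis using S(1) v(1) by (intro exI[of _ "insert v S"]) auto
  qed
qed

text \<open>After \<open>t > 2 * a * ln n\<close> greedy steps at most
  \<open>n * exp (- t / (2 * a)) < 1\<close> vertices are undominated, hence none.\<close>

lemma upper_directed_domination_number_le_independence:
  assumes G: "pair_graph G" and "a \<ge> 1" "pverts G \<noteq> {}"
    and a: "\<And>I. I \<subseteq> pverts G \<Longrightarrow> independent_in (parcs G) I \<Longrightarrow> card I \<le> a"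
  shows "upper_directed_domination_number G \<le> 2 * real a * ln (card (pverts G)) + 1"
proof -
  interpret pair_graph G by fact
  let ?n = "card (pverts G)"
  \<comment> \<open>Floor plus one strictly exceeds \<open>2 * a * ln n\<close>, yet by at most
    one.\<close>
  define t where "t = Suc (nat \<lfloor>2 * real a * ln ?n\<rfloor>)"
  have n: "?n > 0" using assms(3) pair_finite_verts by (simp add: card_gt_0_iff)
  have nonneg: "0 \<le> 2 * real a * ln ?n" using n by simp
  have t: "2 * real a * ln ?n < real t" "real t \<le> 2 * real a * ln ?n + 1"
    using nonneg unfolding t_def by linarith+
  obtain D where D: "orientation G D"
      "\<And>S. directed_dominating_set D S \<Longrightarrow> upper_directed_domination_number G \<le> card S"
    using upper_directed_domination_number_attained[OF G] by blast
  have "upper_directed_domination_number G \<le> t"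
  proof -
    have V: "pverts D = pverts G" using D by (simp add: orientation_def)
    have "\<exists>S\<subseteq>pverts D. card S \<le> t \<and>
        real (card {u \<in> pverts D - S. \<forall>v\<in>S. (v, u) \<notin> parcs D})
          \<le> card (pverts D) * (1 - 1 / (2 * real a)) ^ t"
    proof (rule greedy_domination)
      show "(v, v) \<notin> parcs D" for v
        using D no_loops' by (auto simp: orientation_def)
      show "card I \<le> a" if "I \<subseteq> pverts D" "independent_in (parcs D) I" for I
        using a[of I] that independent_in_orientation[OF G D(1)] V by simp
    qed (use V \<open>a \<ge> 1\<close> pair_finite_verts in auto)
    then obtain S where S: "S \<subseteq> pverts D" "card S \<le> t"
        "real (card {u \<in> pverts D - S. \<forall>v\<in>S. (v, u) \<notin> parcs D})
          \<le> ?n * (1 - 1 / (2 * real a)) ^ t"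
      unfolding V by blast
    note S(3)
    also have "?n * (1 - 1 / (2 * real a)) ^ t \<le> ?n * exp (- (1 / (2 * real a))) ^ t"
      using \<open>a \<ge> 1\<close> exp_ge_add_one_self[of "- (1 / (2 * real a))"]
      by (intro mult_left_mono power_mono) (auto simp: field_simps)
    also have "\<dots> = exp (ln ?n - t / (2 * real a))"
      using n by (simp add: exp_of_nat_mult[symmetric] exp_diff exp_minus field_simps)
    also have "\<dots> < exp 0"
      using t(1) \<open>a \<ge> 1\<close> by (subst exp_less_cancel_iff) (simp add: field_simps)
    finally have "card {u \<in> pverts D - S. \<forall>v\<in>S. (v, u) \<notin> parcs D} = 0" by simp
    then have "{u \<in> pverts D - S. \<forall>v\<in>S. (v, u) \<notin> parcs D} = {}"
      using V pair_finite_verts by (subst (asm) card_0_eq) auto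
    then have "directed_dominating_set D S"
      using S(1) by (auto simp: directed_dominating_set_def)
    with S(2) D(2) show ?thesis using le_trans by blast
  qed
  with t(2) show ?thesis by linarith
qed


section \<open>The matching argument and the upper bound of part (b)\<close>

text \<open>\<open>R1\<close> and \<open>R2\<close> are the arc sets of the two orientations. Peel
  off pairs joined by an arc: in the relation holding that arc the tail alone serves both ends, so
  each pair costs three instead of four; a last single vertex costs two.\<close>

lemma exists_two_dominating_sets:
  assumes "finite W"
    and "\<And>x y. x \<in> W \<Longrightarrow> y \<in> W \<Longrightarrow> x \<noteq> y \<Longrightarrow>
      (x, y) \<in> R1 \<union> R2 \<or> (y, x) \<in> R1 \<union> R2"
  shows "\<exists>S1 S2. S1 \<subseteq> W \<and> S2 \<subseteq> W \<and>
    (\<forall>u\<in>W - S1. \<exists>v\<in>S1. (v, u) \<in> R1) \<and> (\<forall>u\<in>W - S2. \<exists>v\<in>S2. (v, u) \<in> R2) \<and>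
    card S1 + card S2 + card W div 2 \<le> 2 * card W"
  using assms
proof (induction W rule: finite_psubset_induct)
  case (psubset W)
  show ?case
  proof (cases "\<exists>x\<in>W. \<exists>y\<in>W. x \<noteq> y")
    case False
    then have "card W \<le> 1"
      using psubset.hyps(1) by (auto simp: card_le_Suc0_iff_eq)
    then show ?thesis by (intro exI[of _ W]) auto
  next
    case True
    \<comment> \<open>The pair is named so that its arc runs from \<open>x\<close> to
      \<open>y\<close>.\<close>
    with psubset.prems obtain x y where xy: "x \<in> W" "y \<in> W" "x \<noteq> y" "(x, y) \<in> R1 \<union> R2"
      by metis
    let ?W = "W - {x, y}"
    have "?W \<subset> W" using xy by blast
    with psubset.IH[of ?W] psubset.prems obtain S1 S2 where S: "S1 \<subseteq> ?W" "S2 \<subseteq> ?W"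
        "\<forall>u\<in>?W - S1. \<exists>v\<in>S1. (v, u) \<in> R1" "\<forall>u\<in>?W - S2. \<exists>v\<in>S2. (v, u) \<in> R2"
        "card S1 + card S2 + card ?W div 2 \<le> 2 * card ?W"
      by (metis (no_types, lifting) DiffD1)
    have fin: "finite S1" "finite S2"
      using S(1,2) psubset.hyps(1) by (auto intro: finite_subset)
    have "card W = card ?W + 2"
    proof -
      have "W = insert x (insert y ?W)" using xy by blast
      then have "card W = card (insert x (insert y ?W))" by simp
      also have "\<dots> = card ?W + 2" using xy(3) psubset.hyps(1) by simp
      finally show ?thesis .
    qed
    moreover have "card (insert x S1) = card S1 + 1" "card (insert x S2) = card S2 + 1"
        "card (insert x (insert y S1)) = card S1 + 2" "card (insert x (insert y S2)) = card S2 + 2"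
      using S(1,2) fin xy(3) by (subst card_insert_disjoint; auto)+
    \<comment> \<open>One set grows by one, the other by two, and \<open>card W div 2\<close> by
      one: four in all, matching the right-hand side.\<close>
    ultimately have card: "card (insert x S1) + card (insert x (insert y S2)) + card W div 2 \<le> 2 * card W"
        "card (insert x (insert y S1)) + card (insert x S2) + card W div 2 \<le> 2 * card W"
      using S(5) by auto
    have dom: "\<forall>u\<in>W - insert x (insert y S1). \<exists>v\<in>insert x (insert y S1). (v, u) \<in> R1"
        "\<forall>u\<in>W - insert x (insert y S2). \<exists>v\<in>insert x (insert y S2). (v, u) \<in> R2"
      using S(3,4) by blast+
    have sub: "insert x S1 \<subseteq> W" "insert x S2 \<subseteq> W"
        "insert x (insert y S1) \<subseteq> W" "insert x (insert y S2) \<subseteq> W"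
      using S(1,2) xy(1,2) by blast+
    show ?thesis
    proof (cases "(x, y) \<in> R1")
      case True
      then have "\<forall>u\<in>W - insert x S1. \<exists>v\<in>insert x S1. (v, u) \<in> R1"
        using S(3) by blast
      with dom(2) sub(1,4) card(1) show ?thesis by metis
    next
      case False
      then have "\<forall>u\<in>W - insert x S2. \<exists>v\<in>insert x S2. (v, u) \<in> R2"
        using S(4) xy(4) by blast
      with dom(1) sub(2,3) card(2) show ?thesis by metis
    qed
  qed
qed

text \<open>Extremal orientations of \<open>G\<close> and of its complement together join every two
  vertices. Adding \<open>card (pverts G) div 2\<close> on the left avoids natural
  subtraction.\<close>

lemma sum_upper_directed_domination_numbers_le:
  assumes G: "pair_graph G"
  shows "upper_directed_domination_number G + upper_directed_domination_number (graph_complement G)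
      + card (pverts G) div 2 \<le> 2 * card (pverts G)"
proof -
  interpret pair_graph G by fact
  obtain D1 where D1: "orientation G D1"
      "\<And>S. directed_dominating_set D1 S \<Longrightarrow> upper_directed_domination_number G \<le> card S"
    using upper_directed_domination_number_attained[OF G] by blast
  obtain D2 where D2: "orientation (graph_complement G) D2"
      "\<And>S. directed_dominating_set D2 S \<Longrightarrow>
        upper_directed_domination_number (graph_complement G) \<le> card S"
    using upper_directed_domination_number_attained[OF pair_graph_complement[OF G]] by blast
  have cover: "(x, y) \<in> parcs D1 \<union> parcs D2 \<or> (y, x) \<in> parcs D1 \<union> parcs D2"
    if "x \<in> pverts G" "y \<in> pverts G" "x \<noteq> y" for x y
    using D1(1) D2(1) that
    by (cases "(x, y) \<in> parcs G") (auto simp: orientation_def graph_complement_def)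
  have "\<exists>S1 S2. S1 \<subseteq> pverts G \<and> S2 \<subseteq> pverts G \<and>
      (\<forall>u\<in>pverts G - S1. \<exists>v\<in>S1. (v, u) \<in> parcs D1) \<and>
      (\<forall>u\<in>pverts G - S2. \<exists>v\<in>S2. (v, u) \<in> parcs D2) \<and>
      card S1 + card S2 + card (pverts G) div 2 \<le> 2 * card (pverts G)"
    by (rule exists_two_dominating_sets[OF pair_finite_verts]) (rule cover)
  then obtain S1 S2 where S: "S1 \<subseteq> pverts G" "S2 \<subseteq> pverts G"
      "\<forall>u\<in>pverts G - S1. \<exists>v\<in>S1. (v, u) \<in> parcs D1"
      "\<forall>u\<in>pverts G - S2. \<exists>v\<in>S2. (v, u) \<in> parcs D2"
      "card S1 + card S2 + card (pverts G) div 2 \<le> 2 * card (pverts G)"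
    by metis
  have "directed_dominating_set D1 S1" "directed_dominating_set D2 S2"
    using S D1(1) D2(1) by (auto simp: orientation_def directed_dominating_set_def)
  with D1(2) D2(2) S(5) show ?thesis by fastforce
qed

section \<open>Counting tools of the probabilistic method and the two random constructions\<close>

text \<open>Independence in counting form: the conditions concern disjoint parts of
  \<open>P\<close>.\<close>

lemma card_subsets_split:
  assumes "finite P" "B \<subseteq> P"
  shows "card {E. E \<subseteq> P \<and> Q (E \<inter> B) \<and> Q' (E - B)} =
    card {X. X \<subseteq> B \<and> Q X} * card {Y. Y \<subseteq> P - B \<and> Q' Y}"
proof -
  have *: "(X \<union> Y) \<inter> B = X" "X \<union> Y - B = Y" if "X \<subseteq> B" "Y \<subseteq> P - B" for X Y
    using that by auto
  have "bij_betw (\<lambda>E. (E \<inter> B, E - B)) {E. E \<subseteq> P \<and> Q (E \<inter> B) \<and> Q' (E - B)}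
      ({X. X \<subseteq> B \<and> Q X} \<times> {Y. Y \<subseteq> P - B \<and> Q' Y})"
    by (rule bij_betw_byWitness[where f' = "\<lambda>(X, Y). X \<union> Y"])
      (use assms(2) in \<open>auto simp: *\<close>)
  from bij_betw_same_card[OF this] show ?thesis
    by (simp add: card_cartesian_product)
qed

text \<open>For a random \<open>E\<close> the traces on the disjoint blocks \<open>B u\<close> are
  independent, and each misses its forbidden value with probability \<open>1 - 1 / 2 ^ k\<close>;
  denominators are cleared.\<close>

lemma card_subsets_avoiding:
  assumes "finite U" "finite P"
    and "\<And>u. u \<in> U \<Longrightarrow> B u \<subseteq> P \<and> card (B u) = k \<and> T u \<subseteq> B u"
    and "\<And>u v. u \<in> U \<Longrightarrow> v \<in> U \<Longrightarrow> u \<noteq> v \<Longrightarrow> B u \<inter> B v = {}"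
  shows "card {E. E \<subseteq> P \<and> (\<forall>u\<in>U. E \<inter> B u \<noteq> T u)} * 2 ^ (k * card U) =
    (2 ^ k - 1) ^ card U * 2 ^ card P"
  using assms
\<comment> \<open>\<open>P\<close> is generalised because splitting off the block of
  \<open>x\<close> leaves \<open>P - B x\<close>.\<close>
proof (induction U arbitrary: P rule: finite_induct)
  case empty
  then show ?case using card_Pow[of P] by (simp add: Pow_def)
next
  case (insert x U)
  let ?N = "\<lambda>P. {E. E \<subseteq> P \<and> (\<forall>u\<in>U. E \<inter> B u \<noteq> T u)}"
  have x: "B x \<subseteq> P" "card (B x) = k" "T x \<subseteq> B x" using insert.prems(2) by auto
  have finB: "finite (B x)" using x(1) insert.prems(1) by (rule finite_subset)
  have disj: "B u \<inter> B x = {}" if "u \<in> U" for u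
    using insert.prems(3)[of u x] insert.hyps(2) that by auto
  have *: "(E - B x) \<inter> B u = E \<inter> B u" if "u \<in> U" for E u
    using disj[OF that] by blast
  have "{E. E \<subseteq> P \<and> (\<forall>u\<in>insert x U. E \<inter> B u \<noteq> T u)} =
      {E. E \<subseteq> P \<and> E \<inter> B x \<noteq> T x \<and> (\<forall>u\<in>U. (E - B x) \<inter> B u \<noteq> T u)}"
    by (auto simp: *)
  then have "card {E. E \<subseteq> P \<and> (\<forall>u\<in>insert x U. E \<inter> B u \<noteq> T u)} =
      card {X. X \<subseteq> B x \<and> X \<noteq> T x} * card (?N (P - B x))"
    using card_subsets_split[OF insert.prems(1) x(1), of "\<lambda>X. X \<noteq> T x"
        "\<lambda>Y. \<forall>u\<in>U. Y \<inter> B u \<noteq> T u"] by simp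
  also have "{X. X \<subseteq> B x \<and> X \<noteq> T x} = Pow (B x) - {T x}" by auto
  also have "card \<dots> = 2 ^ k - 1"
    using x finB by (simp add: card_Diff_subset card_Pow)
  finally have N: "card {E. E \<subseteq> P \<and> (\<forall>u\<in>insert x U. E \<inter> B u \<noteq> T u)} =
      (2 ^ k - 1) * card (?N (P - B x))" .
  have IH: "card (?N (P - B x)) * 2 ^ (k * card U) = (2 ^ k - 1) ^ card U * 2 ^ card (P - B x)"
  proof (rule insert.IH)
    show "B u \<subseteq> P - B x \<and> card (B u) = k \<and> T u \<subseteq> B u" if "u \<in> U" for u
      using insert.prems(2)[of u] disj[OF that] that by blast
  qed (use insert.prems in auto)
  have "card P = k + card (P - B x)"
    using x insert.prems(1) by (metis add.commute card_Diff_subset card_mono finB le_add_diff_inverse2)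
  moreover have "k * card (insert x U) = k + k * card U"
    using insert.hyps by simp
  ultimately show ?case
    using IH insert.hyps unfolding N
    by (simp add: power_add mult_ac)
qed

text \<open>The union bound of the probabilistic method, with \<open>d / c\<close> bounding the probability of
  each bad event.\<close>

lemma exists_subset_avoiding_bad_events:
  assumes "finite P" "finite J"
    and bad: "\<And>j. j \<in> J \<Longrightarrow> card {E. E \<subseteq> P \<and> bad j E} * c \<le> d * 2 ^ card P"
    and less: "card J * d < c"
  shows "\<exists>E\<subseteq>P. \<forall>j\<in>J. \<not> bad j E"
proof (rule ccontr)
  assume "\<not> ?thesis"
  then have "Pow P = (\<Union>j\<in>J. {E. E \<subseteq> P \<and> bad j E})" by auto
  then have "2 ^ card P = card (\<Union>j\<in>J. {E. E \<subseteq> P \<and> bad j E})"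
    using card_Pow[OF assms(1)] by simp
  also have "\<dots> \<le> (\<Sum>j\<in>J. card {E. E \<subseteq> P \<and> bad j E})"
    using assms(2) by (rule card_UN_le)
  finally have "2 ^ card P * c \<le> (\<Sum>j\<in>J. card {E. E \<subseteq> P \<and> bad j E}) * c"
    by (rule mult_le_mono1)
  also have "\<dots> \<le> (\<Sum>j\<in>J. d * 2 ^ card P)"
    unfolding sum_distrib_right using bad by (rule sum_mono)
  also have "\<dots> = (card J * d) * 2 ^ card P" by simp
  also have "\<dots> < c * 2 ^ card P" using less by simp
  finally show False by (simp add: mult.commute)
qed

text \<open>A set \<open>E\<close> of subsets of \<open>{..<n}\<close>, of which only the two-element ones matter, encodes the
  tournament in which \<open>u\<close> beats \<open>s\<close> iff \<open>({u, s} \<in> E) = (u < s)\<close>.\<close>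

lemma exists_tournament_without_small_dominating_set:
  assumes "(n choose k) * (2 ^ k - 1) ^ (n - k) < (2::nat) ^ (k * (n - k))"
  shows "\<exists>E :: nat set set. \<forall>S. S \<subseteq> {..<n} \<longrightarrow> card S = k \<longrightarrow>
    (\<exists>u\<in>{..<n} - S. \<forall>s\<in>S. ({u, s} \<in> E) = (u < s))"
proof -
  let ?P = "Pow {..<n}"
  let ?J = "{S. S \<subseteq> {..<n} \<and> card S = k}"
  \<comment> \<open>\<open>B S u\<close> holds the pairs deciding the games of \<open>u\<close>
    against \<open>S\<close>, and \<open>T S u\<close> is the one pattern on them in which
    \<open>u\<close> beats all of \<open>S\<close>.\<close>
  define B where "B S u = (\<lambda>s. {u, s}) ` S" for S and u :: nat
  define T where "T S u = (\<lambda>s. {u, s}) ` {s \<in> S. u < s}" for S and u :: nat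
  have "\<exists>E\<subseteq>?P. \<forall>S\<in>?J. \<not> (\<forall>u\<in>{..<n} - S. E \<inter> B S u \<noteq> T S u)"
  proof (rule exists_subset_avoiding_bad_events)
    fix S assume S: "S \<in> ?J"
    then have fin: "finite S" by (auto intro: finite_subset)
    then have "card ({..<n} - S) = n - k" using S by (simp add: card_Diff_subset)
    moreover have "B S u \<subseteq> ?P \<and> card (B S u) = k \<and> T S u \<subseteq> B S u" if "u \<in> {..<n} - S" for u
    proof (intro conjI)
      have "inj_on (\<lambda>s. {u, s}) S" by (auto simp: inj_on_def doubleton_eq_iff)
      then show "card (B S u) = k" using S by (simp add: B_def card_image)
    qed (use S that in \<open>auto simp: B_def T_def\<close>)
    \<comment> \<open>A pair with exactly one end in \<open>S\<close> determines its end outside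
      \<open>S\<close>.\<close>
    moreover have "B S u \<inter> B S v = {}" if "u \<in> {..<n} - S" "v \<in> {..<n} - S" "u \<noteq> v" for u v
      using that by (auto simp: B_def doubleton_eq_iff)
    ultimately show "card {E. E \<subseteq> ?P \<and> (\<forall>u\<in>{..<n} - S. E \<inter> B S u \<noteq> T S u)} * 2 ^ (k * (n - k))
        \<le> (2 ^ k - 1) ^ (n - k) * 2 ^ card ?P"
      using card_subsets_avoiding[of "{..<n} - S" ?P "B S" k "T S"] by simp
  qed (use assms n_subsets[of "{..<n}" k] in auto)
  then obtain E where E: "\<forall>S\<in>?J. \<not> (\<forall>u\<in>{..<n} - S. E \<inter> B S u \<noteq> T S u)"
    by metis
  show ?thesis
  proof (intro exI[of _ E] allI impI)
    fix S assume S: "S \<subseteq> {..<n}" "card S = k"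
    then have "S \<in> ?J" by simp
    with E obtain u where u: "u \<in> {..<n} - S" "E \<inter> B S u = T S u" by metis
    have "({u, s} \<in> E) = (u < s)" if "s \<in> S" for s
    proof -
      have "{u, s} \<in> B S u" using that by (simp add: B_def)
      moreover have "{u, s} \<in> T S u \<longleftrightarrow> u < s"
        using that by (auto simp: T_def doubleton_eq_iff)
      ultimately show ?thesis using u(2) by blast
    qed
    with u(1) show "\<exists>u\<in>{..<n} - S. \<forall>s\<in>S. ({u, s} \<in> E) = (u < s)" by blast
  qed
qed

text \<open>A random edge set contains all pairs of a given \<open>k\<close>-set, or none, each with
  probability \<open>1 / 2 ^ (k choose 2)\<close>; there are \<open>2 * (n choose k)\<close> such
  bad events.\<close>

lemma exists_two_sided_ramsey_graph:
  assumes "2 * (n choose k) < (2::nat) ^ (k choose 2)"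
  shows "\<exists>E :: nat set set. \<forall>S. S \<subseteq> {..<n} \<longrightarrow> card S = k \<longrightarrow>
    (\<exists>e\<in>E. e \<subseteq> S \<and> card e = 2) \<and> (\<exists>e. e \<notin> E \<and> e \<subseteq> S \<and> card e = 2)"
proof -
  let ?P = "Pow {..<n}"
  \<comment> \<open>The Boolean selects the bad event: all pairs of \<open>S\<close> for
    \<open>True\<close>, none for \<open>False\<close>.\<close>
  let ?J = "{S. S \<subseteq> {..<n} \<and> card S = k} \<times> (UNIV :: bool set)"
  define B where "B S = {e. e \<subseteq> S \<and> card e = 2}" for S :: "nat set"
  have "\<exists>E\<subseteq>?P. \<forall>j\<in>?J. \<not> E \<inter> B (fst j) = (if snd j then B (fst j) else {})"
  proof (rule exists_subset_avoiding_bad_events)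
    fix j assume "j \<in> ?J"
    then obtain S b where j: "j = (S, b)" "S \<subseteq> {..<n}" "card S = k" by auto
    then have fin: "finite S" by (auto intro: finite_subset)
    have B: "B S \<subseteq> ?P" "card (B S) = k choose 2"
      using j n_subsets[OF fin] by (auto simp: B_def)
    have finB: "finite (B S)" using B(1) by (rule finite_subset) simp
    let ?T = "if b then B S else {}"
    have "card {E. E \<subseteq> ?P \<and> E \<inter> B S = ?T} = card {X. X \<subseteq> B S \<and> X = ?T} * card (Pow (?P - B S))"
      using card_subsets_split[of ?P "B S" "\<lambda>X. X = ?T" "\<lambda>_. True"] B(1)
      by (simp add: Pow_def)
    also have "{X. X \<subseteq> B S \<and> X = ?T} = {?T}" by auto
    also have "card (Pow (?P - B S)) = 2 ^ card (?P - B S)" by (intro card_Pow) simp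
    finally have "card {E. E \<subseteq> ?P \<and> E \<inter> B S = ?T} * 2 ^ card (B S) =
        2 ^ (card (?P - B S) + card (B S))"
      by (simp add: power_add)
    also have "card (?P - B S) + card (B S) = card ?P"
      using B(1) finB by (metis card_Diff_subset card_mono finite_Pow_iff finite_lessThan le_add_diff_inverse2)
    finally show "card {E. E \<subseteq> ?P \<and> E \<inter> B (fst j) = (if snd j then B (fst j) else {})} *
        2 ^ (k choose 2) \<le> 1 * 2 ^ card ?P"
      using B(2) j(1) by (simp only: fst_conv snd_conv mult_1_left order_refl)
  qed (use assms n_subsets[of "{..<n}" k] in \<open>auto simp: card_cartesian_product\<close>)
  then obtain E where E: "\<forall>j\<in>?J. E \<inter> B (fst j) \<noteq> (if snd j then B (fst j) else {})"
    by metis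
  show ?thesis
  proof (intro exI[of _ E] allI impI)
    fix S assume S: "S \<subseteq> {..<n}" "card S = k"
    have "E \<inter> B S \<noteq> {}" using bspec[OF E, of "(S, False)"] S by simp
    moreover have "\<not> B S \<subseteq> E" using bspec[OF E, of "(S, True)"] S by auto
    ultimately show "(\<exists>e\<in>E. e \<subseteq> S \<and> card e = 2) \<and> (\<exists>e. e \<notin> E \<and> e \<subseteq> S \<and> card e = 2)"
      unfolding B_def by blast
  qed
qed

section \<open>A graph with small cliques and independent sets: the upper bound of part (a)\<close>

text \<open>The side conditions on \<open>u\<close> and \<open>v\<close> make every \<open>E\<close>
  admissible, so the random families need no cleaning. The complement of
  \<open>graph_on n {}\<close> is the complete graph.\<close>

definition graph_on :: "nat \<Rightarrow> nat set set \<Rightarrow> nat pair_pre_digraph" where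
  "graph_on n E = \<lparr> pverts = {..<n}, parcs = {(u, v). u < n \<and> v < n \<and> u \<noteq> v \<and> {u, v} \<in> E} \<rparr>"

lemma pverts_graph_on [simp]: "pverts (graph_on n E) = {..<n}"
  by (simp add: graph_on_def)

lemma pair_graph_graph_on: "pair_graph (graph_on n E)"
proof -
  have "finite (parcs (graph_on n E))"
    by (rule finite_subset[of _ "{..<n} \<times> {..<n}"]) (auto simp: graph_on_def)
  then show ?thesis
    by unfold_locales (auto simp: graph_on_def symmetric_def sym_def insert_commute)
qed

lemma independent_in_subset: "independent_in R I \<Longrightarrow> J \<subseteq> I \<Longrightarrow> independent_in R J"
  by (auto simp: independent_in_def)

text \<open>From \<open>n choose k \<le> n ^ k / fact k\<close>: the factor 2 is absorbed by
  \<open>fact k \<ge> 6\<close>, and \<open>n ^ k \<le> 2 ^ (k choose 2)\<close> follows by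
  comparing squares, which avoids halving exponents.\<close>

lemma two_mult_binomial_less:
  assumes "n \<ge> 2" "k \<ge> 3" "n\<^sup>2 \<le> (2::nat) ^ (k - 1)"
  shows "2 * (n choose k) < (2::nat) ^ (k choose 2)"
proof (cases "n choose k = 0")
  case False
  have "even (k * (k - 1))" by (cases k) auto
  then have "2 * (k choose 2) = (k - 1) * k" by (simp add: choose_two)
  then have "(2 ^ (k choose 2))\<^sup>2 = ((2::nat) ^ (k - 1)) ^ k"
    by (simp add: power_mult[symmetric] mult.commute)
  moreover have "(n ^ k)\<^sup>2 = (n\<^sup>2) ^ k"
    by (simp add: power_mult[symmetric] mult.commute)
  ultimately have "(n ^ k)\<^sup>2 \<le> (2 ^ (k choose 2))\<^sup>2"
    using assms(3) by (simp add: power_mono)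
  then have le: "n ^ k \<le> 2 ^ (k choose 2)"
    by (simp add: power2_nat_le_eq_le)
  have "(fact 3 :: nat) \<le> fact k" using assms(2) by (rule fact_mono_nat)
  then have "2 < (fact k :: nat)" by (simp add: fact_numeral)
  then have "2 * (n choose k) < (n choose k) * fact k"
    using False by (simp add: mult.commute)
  also have "\<dots> \<le> n ^ k" by (rule binomial_fact_pow)
  finally show ?thesis using le by simp
next
  case True
  then show ?thesis by (simp only: mult_0_right zero_less_power zero_less_numeral)
qed

text \<open>A larger independent set would contain one of size \<open>k\<close>, so with
  \<open>x = log 2 n \<ge> 1\<close> the independence number is at most
  \<open>k - 1 \<le> 3 * x\<close>. The greedy bound is then at most
  \<open>6 * x\<^sup>2 + 1 \<le> 7 * x\<^sup>2\<close>.\<close>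

lemma upper_directed_domination_number_le_log_squared:
  assumes G: "pair_graph G" and n: "card (pverts G) = n" "n \<ge> 2" "k = Suc (nat \<lceil>2 * log 2 n\<rceil>)"
    and no: "\<And>S. S \<subseteq> pverts G \<Longrightarrow> card S = k \<Longrightarrow> \<not> independent_in (parcs G) S"
  shows "upper_directed_domination_number G \<le> 7 * (log 2 n)\<^sup>2"
proof -
  interpret pair_graph G by fact
  let ?x = "log 2 n" and ?a = "nat \<lceil>2 * log 2 n\<rceil>"
  have x: "1 \<le> ?x" using n(2) by (simp add: le_log_iff)
  then have a: "1 \<le> ?a" "?a \<le> 3 * ?x" by linarith+
  have "card I \<le> ?a" if "I \<subseteq> pverts G" "independent_in (parcs G) I" for I
  proof (rule ccontr)
    assume "\<not> ?thesis"
    then have "k \<le> card I" using n(3) by simp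
    then obtain S where "S \<subseteq> I" "card S = k" by (meson obtain_subset_with_card_n)
    then show False using no[of S] that independent_in_subset by blast
  qed
  then have "upper_directed_domination_number G \<le> 2 * real ?a * ln n + 1"
    using upper_directed_domination_number_le_independence[OF G a(1)] n(1,2) by fastforce
  also have "ln n \<le> ?x"
  proof -
    have "ln (real n) * ln 2 \<le> ln n * 1"
      using ln_2_less_1 n(2) by (intro mult_left_mono) auto
    then show ?thesis by (simp add: log_def field_simps)
  qed
  then have "2 * real ?a * ln n \<le> 2 * (3 * ?x) * ?x"
    using a x n(2) by (intro mult_mono) auto
  also have "2 * (3 * ?x) * ?x + 1 \<le> 7 * ?x\<^sup>2"
    using x by (simp add: power2_eq_square mult_mono[of 1 ?x 1 ?x, simplified])
  finally show ?thesis by simp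
qed

lemma exists_graph_sum_le_log_squared:
  assumes n: "n \<ge> 2"
  shows "\<exists>E. upper_directed_domination_number (graph_on n E)
    + upper_directed_domination_number (graph_complement (graph_on n E)) \<le> 14 * (log 2 n)\<^sup>2"
proof -
  \<comment> \<open>The least natural \<open>k\<close> with \<open>k - 1 \<ge> 2 * log 2 n\<close>,
    that is, with \<open>n\<^sup>2 \<le> 2 ^ (k - 1)\<close>.\<close>
  define k where "k = Suc (nat \<lceil>2 * log 2 n\<rceil>)"
  have x: "1 \<le> log 2 n" using n by (simp add: le_log_iff)
  then have "k \<ge> 3" unfolding k_def by linarith
  have "log 2 (real (n\<^sup>2)) \<le> real (k - 1)"
    using x n unfolding k_def by (simp add: log_nat_power)
  then have "real (n\<^sup>2) \<le> 2 powr real (k - 1)"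
    using n by (subst (asm) log_le_iff) auto
  then have "real (n\<^sup>2) \<le> real (2 ^ (k - 1))"
    by (simp add: powr_realpow)
  then have "n\<^sup>2 \<le> 2 ^ (k - 1)"
    using of_nat_le_iff by blast
  then have "2 * (n choose k) < 2 ^ (k choose 2)"
    using n \<open>k \<ge> 3\<close> by (intro two_mult_binomial_less)
  from exists_two_sided_ramsey_graph[OF this]
  obtain E :: "nat set set" where E: "\<forall>S. S \<subseteq> {..<n} \<longrightarrow> card S = k \<longrightarrow>
      (\<exists>e\<in>E. e \<subseteq> S \<and> card e = 2) \<and> (\<exists>e. e \<notin> E \<and> e \<subseteq> S \<and> card e = 2)"
    by blast
  have "\<not> independent_in (parcs (graph_on n E)) S"
    if S: "S \<subseteq> {..<n}" "card S = k" for S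
  proof -
    obtain e where e: "e \<in> E" "e \<subseteq> S" "card e = 2" using E S by blast
    then obtain u v where uv: "e = {u, v}" "u \<noteq> v" by (auto simp: card_2_iff)
    with e S(1) have "(u, v) \<in> parcs (graph_on n E)" "u \<in> S" "v \<in> S"
      by (auto simp: graph_on_def)
    with uv(2) show ?thesis unfolding independent_in_def by blast
  qed
  then have 1: "upper_directed_domination_number (graph_on n E) \<le> 7 * (log 2 n)\<^sup>2"
    using n k_def
    by (intro upper_directed_domination_number_le_log_squared pair_graph_graph_on) auto
  have "\<not> independent_in (parcs (graph_complement (graph_on n E))) S"
    if S: "S \<subseteq> {..<n}" "card S = k" for S
  proof -
    obtain e where e: "e \<notin> E" "e \<subseteq> S" "card e = 2" using E S by blast
    then obtain u v where uv: "e = {u, v}" "u \<noteq> v" by (auto simp: card_2_iff)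
    with e S(1) have "(u, v) \<in> parcs (graph_complement (graph_on n E))" "u \<in> S" "v \<in> S"
      by (auto simp: graph_on_def graph_complement_def)
    with uv(2) show ?thesis unfolding independent_in_def by blast
  qed
  then have 2: "upper_directed_domination_number (graph_complement (graph_on n E)) \<le> 7 * (log 2 n)\<^sup>2"
    using n k_def
    by (intro upper_directed_domination_number_le_log_squared pair_graph_complement
        pair_graph_graph_on) auto
  from 1 2 show ?thesis by (intro exI[of _ E]) simp
qed

section \<open>Random tournaments and the lower bound of part (b)\<close>

text \<open>The encoded tournament orients the complete graph, and a vertex beating all of
  \<open>S\<close> is not dominated by \<open>S\<close>.\<close>

lemma less_upper_directed_domination_number_complete:
  assumes less: "(n choose k) * (2 ^ k - 1) ^ (n - k) < (2::nat) ^ (k * (n - k))" and "k \<le> n"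
  shows "k < upper_directed_domination_number (graph_complement (graph_on n {}))"
proof -
  let ?K = "graph_complement (graph_on n {})"
  obtain E :: "nat set set" where E: "\<And>S. S \<subseteq> {..<n} \<Longrightarrow> card S = k \<Longrightarrow>
      \<exists>u\<in>{..<n} - S. \<forall>s\<in>S. ({u, s} \<in> E) = (u < s)"
    using exists_tournament_without_small_dominating_set[OF less] by metis
  let ?D = "\<lparr> pverts = {..<n},
    parcs = {(u, v). u < n \<and> v < n \<and> u \<noteq> v \<and> ({u, v} \<in> E) = (u < v)} \<rparr>"
  have "orientation ?K ?D"
    by (auto simp: orientation_def graph_complement_def graph_on_def insert_commute)
  moreover have "Suc k \<le> card S" if S: "directed_dominating_set ?D S" for S
  proof (rule ccontr)
    assume "\<not> Suc k \<le> card S"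
    moreover have sub: "S \<subseteq> {..<n}" using S by (simp add: directed_dominating_set_def)
    \<comment> \<open>Sets with fewer than \<open>k\<close> vertices are padded to size
      \<open>k\<close>, as \<open>E\<close> only speaks of that size.\<close>
    ultimately obtain S' where S': "S \<subseteq> S'" "S' \<subseteq> {..<n}" "card S' = k"
      using exists_subset_between[of S k "{..<n}"] \<open>k \<le> n\<close> by auto
    with E obtain u where u: "u \<in> {..<n} - S'" "\<forall>s\<in>S'. ({u, s} \<in> E) = (u < s)" by blast
    then have "u \<in> {..<n} - S" using S' by blast
    with S obtain v where v: "v \<in> S" "(v, u) \<in> parcs ?D"
      by (auto simp: directed_dominating_set_def)
    then have "({u, v} \<in> E) = (v < u)" "u \<noteq> v" by (auto simp: insert_commute)
    moreover have "({u, v} \<in> E) = (u < v)" using u(2) v(1) S'(1) by blast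
    ultimately show False by auto
  qed
  ultimately have "Suc k \<le> upper_directed_domination_number ?K"
    by (rule upper_directed_domination_number_geI[OF pair_graph_complement[OF pair_graph_graph_on]])
  then show ?thesis by simp
qed

text \<open>The ratio of the two sides is at most \<open>exp (k * ln n - (n - k) / 2 ^ k)\<close>.
  The choice of \<open>k\<close> gives \<open>2 ^ k * x\<^sup>2 < n\<close>, so the subtracted term
  exceeds \<open>x\<^sup>2 - 1 / 2\<close>, while
  \<open>k * ln n \<le> 3 / 4 * x\<^sup>2\<close>.\<close>

lemma tournament_counting_bound:
  fixes n k :: nat
  defines "x \<equiv> log 2 (real n)"
  assumes n: "n \<ge> 3" and k: "k \<ge> 1" "real k < x - 2 * log 2 x" and "k \<le> n"
  shows "(n choose k) * (2 ^ k - 1) ^ (n - k) < (2::nat) ^ (k * (n - k))"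
proof -
  \<comment> \<open>\<open>9 \<ge> 2 ^ 3\<close> yields \<open>x \<ge> 3 / 2\<close>.\<close>
  have "3 ^ 2 \<le> (real n)\<^sup>2" using n by (intro power_mono) auto
  then have "3 \<le> log 2 ((real n)\<^sup>2)" using n by (simp add: le_log_iff)
  then have x: "3 / 2 \<le> x" using n by (simp add: x_def log_nat_power)
  have n_eq: "2 powr x = n" using n by (simp add: x_def)
  have "2 powr real k < 2 powr (x - 2 * log 2 x)" using k(2) by simp
  also have "\<dots> = n / x\<^sup>2"
    using x n_eq by (simp add: powr_diff powr_powr[symmetric] mult.commute[of 2] flip: powr_numeral)
  finally have 2: "2 ^ k * x\<^sup>2 < n" using x by (simp add: powr_realpow field_simps)
  have "0 \<le> log 2 x" using x by simp
  then have kx: "real k \<le> x" using k(2) by simp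
  have "2 \<le> exp (3 / 4 :: real)"
    using exp_lower_Taylor_quadratic[of "3 / 4"] by (simp add: power2_eq_square)
  then have "ln 2 \<le> (3 / 4 :: real)" by (metis exp_le_cancel_iff exp_ln zero_less_numeral)
  then have "x * ln 2 \<le> x * (3 / 4)" using x by (intro mult_left_mono) auto
  moreover have "ln (real n) = x * ln 2" by (simp add: x_def log_def)
  ultimately have ln: "ln n \<le> 3 / 4 * x" by simp
  have "k * ln n \<le> x * (3 / 4 * x)"
    using kx ln n x by (intro mult_mono) auto
  \<comment> \<open>Here \<open>x \<ge> 3 / 2\<close> enters:
    \<open>x\<^sup>2 / 4 \<ge> 9 / 16 > 1 / 2\<close>.\<close>
  also have "\<dots> \<le> x\<^sup>2 - 1 / 2"
    using mult_mono[OF x x] x by (simp add: power2_eq_square)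
  also have "\<dots> < (n - real k) / 2 ^ k"
  proof -
    \<comment> \<open>The loss \<open>k / 2 ^ k\<close> is at most \<open>1 / 2\<close>.\<close>
    have "2 * k \<le> 2 ^ k" using k(1)
      by (induction k rule: nat_induct_at_least) auto
    then have "2 * real k \<le> 2 ^ k" by (metis of_nat_le_iff of_nat_mult of_nat_numeral of_nat_power)
    then have "(x\<^sup>2 - 1 / 2) * 2 ^ k < n - real k" using 2 by (simp add: algebra_simps)
    then show ?thesis by (simp add: field_simps)
  qed
  finally have key: "k * ln n - (n - real k) / 2 ^ k < 0" by simp
  have "real ((n choose k) * (2 ^ k - 1) ^ (n - k)) \<le> n ^ k * (2 ^ k - 1) ^ (n - k)"
    using binomial_le_pow[OF \<open>k \<le> n\<close>]
    by (simp add: of_nat_diff mult_right_mono flip: of_nat_power)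
  also have "\<dots> = n ^ k * (1 - 1 / 2 ^ k) ^ (n - k) * 2 ^ (k * (n - k))"
    by (simp add: power_mult power_mult_distrib[symmetric] left_diff_distrib)
  also have "\<dots> \<le> n ^ k * exp (- (1 / 2 ^ k)) ^ (n - k) * 2 ^ (k * (n - k))"
    using exp_ge_add_one_self[of "- (1 / 2 ^ k)"]
    by (intro mult_right_mono mult_left_mono power_mono) auto
  also have "\<dots> = exp (k * ln n - (n - real k) / 2 ^ k) * 2 ^ (k * (n - k))"
  proof -
    have "exp (k * ln n) = real n ^ k" using n by (simp add: exp_of_nat_mult)
    moreover have "exp (- (1 / 2 ^ k)) ^ (n - k) = exp (- ((n - real k) / 2 ^ k))"
      using \<open>k \<le> n\<close> by (simp add: exp_of_nat_mult[symmetric] of_nat_diff)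
    ultimately show ?thesis by (simp add: exp_diff exp_minus divide_inverse)
  qed
  also have "\<dots> < 1 * 2 ^ (k * (n - k))"
    using key by (intro mult_strict_right_mono) auto
  finally have "real ((n choose k) * (2 ^ k - 1) ^ (n - k)) < real (2 ^ (k * (n - k)))"
    by simp
  then show ?thesis using of_nat_less_iff by blast
qed

text \<open>When the left side is at most 1, a single vertex as independent set suffices; otherwise
  the tournament bound applies.\<close>

lemma log_le_upper_directed_domination_number_complete:
  assumes n: "n \<ge> 2"
  shows "log 2 n - 2 * log 2 (log 2 n)
    \<le> upper_directed_domination_number (graph_complement (graph_on n {}))"
proof (cases "log 2 n - 2 * log 2 (log 2 n) \<le> 1")
  case True
  have "0 < upper_directed_domination_number (graph_complement (graph_on n {}))"
    using independent_card_le_upper_directed_domination_number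
        [OF pair_graph_complement[OF pair_graph_graph_on], of "{0}" n "{}"] n
    by (simp add: independent_in_def)
  with True show ?thesis by linarith
next
  case False
  let ?L = "log 2 n - 2 * log 2 (log 2 n)"
  \<comment> \<open>The largest integer strictly below \<open>?L\<close>; the strict bound
    \<open>k < \<Gamma>\<^sub>d\<close> then recovers all of \<open>?L \<le> k + 1\<close>.\<close>
  define k where "k = nat (\<lceil>?L\<rceil> - 1)"
  have k: "k \<ge> 1" "real k < ?L" "?L \<le> real k + 1"
    using False unfolding k_def by linarith+
  \<comment> \<open>For \<open>n = 2\<close> the left side equals 1, the case already
    settled.\<close>
  have "n \<noteq> 2" using False by auto
  with n have "n \<ge> 3" by simp
  have "1 \<le> log 2 n" using n by (simp add: le_log_iff)
  then have "real k < log 2 n" using k(2) by (smt (verit) zero_le_log_cancel_iff)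
  moreover have "log 2 n \<le> n"
    using n less_exp[of n] by (intro log2_of_power_le) auto
  ultimately have "k \<le> n" by linarith
  have "k < upper_directed_domination_number (graph_complement (graph_on n {}))"
    using tournament_counting_bound[OF \<open>n \<ge> 3\<close> k(1,2) \<open>k \<le> n\<close>] \<open>k \<le> n\<close>
    by (rule less_upper_directed_domination_number_complete)
  with k(3) show ?thesis by linarith
qed

section \<open>Assembling the four bounds\<close>

lemma graph_on_in_ndg_values:
  "upper_directed_domination_number (graph_on n E)
    + upper_directed_domination_number (graph_complement (graph_on n E)) \<in> ndg_values n"
  unfolding ndg_values_def using pair_graph_graph_on[of n E] by fastforce

theorem theorem2p10:
  shows "(\<exists>c1 c2 :: real. c1 > 0 \<and> c2 > 0 \<and>
            (\<forall>n :: nat. n \<ge> 2 \<longrightarrow>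
               c1 * log 2 (real n) \<le> real (ndg_min n) \<and>
               real (ndg_min n) \<le> c2 * (log 2 (real n))\<^sup>2)) \<and>
         (\<forall>n :: nat. n \<ge> 2 \<longrightarrow>
               real n + log 2 (real n) - 2 * log 2 (log 2 (real n)) \<le> real (ndg_max n) \<and>
               int (ndg_max n) \<le> int n + \<lceil>real n / 2\<rceil>)"
\<comment> \<open>The constant 14 is 7 for the graph plus 7 for its complement.\<close>
proof (rule conjI, rule exI[of _ 1], rule exI[of _ 14], safe)
  fix n :: nat assume n: "n \<ge> 2"
  have "ndg_min n \<in> ndg_values n"
    unfolding ndg_min_def by (rule Min_in[OF ndg_values_finite ndg_values_nonempty])
  then obtain G :: "nat pair_pre_digraph" where G: "pair_graph G" "card (pverts G) = n"
      "ndg_min n = upper_directed_domination_number G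
        + upper_directed_domination_number (graph_complement G)"
    by (auto simp: ndg_values_def)
  have "pverts G \<noteq> {}" using G(2) n by auto
  from log_card_le_sum_upper_directed_domination_numbers[OF G(1) this]
  show "1 * log 2 (real n) \<le> real (ndg_min n)" using G(2,3) by simp
next
  fix n :: nat assume n: "n \<ge> 2"
  obtain E where E: "upper_directed_domination_number (graph_on n E)
      + upper_directed_domination_number (graph_complement (graph_on n E)) \<le> 14 * (log 2 n)\<^sup>2"
    using exists_graph_sum_le_log_squared[OF n] by blast
  have "ndg_min n \<le> upper_directed_domination_number (graph_on n E)
      + upper_directed_domination_number (graph_complement (graph_on n E))"
    unfolding ndg_min_def by (rule Min_le[OF ndg_values_finite graph_on_in_ndg_values])
  with E show "real (ndg_min n) \<le> 14 * (log 2 (real n))\<^sup>2" by linarith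
next
  fix n :: nat assume n: "n \<ge> 2"
  \<comment> \<open>In the edgeless graph all \<open>n\<close> vertices are independent, which gives
    the summand \<open>n\<close>.\<close>
  have "card {..<n} \<le> upper_directed_domination_number (graph_on n {})"
    by (rule independent_card_le_upper_directed_domination_number[OF pair_graph_graph_on])
      (auto simp: independent_in_def graph_on_def)
  moreover have "upper_directed_domination_number (graph_on n {})
      + upper_directed_domination_number (graph_complement (graph_on n {})) \<le> ndg_max n"
    unfolding ndg_max_def by (rule Max_ge[OF ndg_values_finite graph_on_in_ndg_values])
  ultimately show "real n + log 2 (real n) - 2 * log 2 (log 2 (real n)) \<le> real (ndg_max n)"
    using log_le_upper_directed_domination_number_complete[OF n] by simp
next
  fix n :: nat
  have "ndg_max n \<in> ndg_values n"
    unfolding ndg_max_def by (rule Max_in[OF ndg_values_finite ndg_values_nonempty])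
  then obtain G :: "nat pair_pre_digraph" where G: "pair_graph G" "card (pverts G) = n"
      "ndg_max n = upper_directed_domination_number G
        + upper_directed_domination_number (graph_complement G)"
    by (auto simp: ndg_values_def)
  have "ndg_max n + n div 2 \<le> 2 * n"
    using sum_upper_directed_domination_numbers_le[OF G(1)] G(2,3) by simp
  moreover have "\<lceil>real n / 2\<rceil> = int n - int (n div 2)"
    by (simp add: ceiling_eq_iff) linarith
  ultimately show "int (ndg_max n) \<le> int n + \<lceil>real n / 2\<rceil>" by linarith
qed auto

end
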